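(* Each magnetic geodesic of the magnetic system $(\mathbb{S}^\infty_{L^2},\mathcal{G}^{L^2},\mathrm{d}\alpha)$ with initial values $(f,F)\in T\mathbb{S}^\infty_{L^2}$ is contained in a three-dimensional sphere $\mathbb{S}^3(f,F)$, obtained by intersecting $\mathbb{S}^\infty_{L^2}$ with the complex plane $\mathrm{span}_{\mathbb{C}}\{f,F\}\subset L^2(\mathbb{S}^1,\mathbb{C})$.
   Context: **Sphere.** $\mathbb{S}^1=\mathbb{R}/\mathbb{Z}$, $\mathbb{S}^\infty_{L^2}=\{f\in L^2(\mathbb{S}^1,\mathbb{C}):\|f\|_{L^2}=1\}$, $T_f\mathbb{S}^\infty_{L^2}=\{F\in L^2(\mathbb{S}^1,\mathbb{C}):\mathrm{Re}\langle f,F\rangle_{L^2}=0\}$, $\mathcal{G}^{L^2}=\mathrm{Re}\langle\cdot,\cdot\rangle_{L^2}$ restricted to the sphere, and $\alpha_f(F)=\tfrac12\mathrm{Re}\langle\mathrm{i}f,F\rangle_{L^2}$. **Magnetic geodesics.** For a Riemannian Hilbert manifold $(M,g)$ and a closed two-form $\sigma$ on $M$, the Lorentz force $Y:TM\to TM$ is defined by $g_q(Y_qu,v)=\sigma_q(u,v)$, and a curve $\gamma:\mathbb{R}\to M$ is a magnetic geodesic of $(M,g,\sigma)$ if $\nabla_{\dot\gamma}\dot\gamma=Y_\gamma\dot\gamma$, with $\nabla$ the Levi-Civita connection. It has initial values $(f,F)$ if $\gamma(0)=f$, $\dot\gamma(0)=F$.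
   Formalization: The intersection is claimed to be a three-dimensional sphere only when f and F are linearly independent over the complex numbers (otherwise, e.g. for F = 0, it is a circle); the containment of the geodesic in the intersection is proved in all cases. *)

theory Defs
  imports "HOL-Analysis.Analysis"
begin

section \<open>The Hilbert space \<open>L\<^sup>2(\<real>/\<int>, \<complex>)\<close>\<close>

quotient_type circle = real / "\<lambda>x y::real. x - y \<in> \<int>"
proof (rule equivpI)
  show "reflp (\<lambda>x y::real. x - y \<in> \<int>)" by (simp add: reflp_def)
  show "symp (\<lambda>x y::real. x - y \<in> \<int>)"
    by (auto simp: symp_def) (metis Ints_minus minus_diff_eq)
  show "transp (\<lambda>x y::real. x - y \<in> \<int>)"
    by (auto simp: transp_def) (metis Ints_add diff_add_cancel add_diff_eq)
qed

text \<open>The Haar probability measure of \<open>\<real>/\<int>\<close>: the image of Lebesgue measure on the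
  fundamental domain \<open>[0,1)\<close>, on the quotient of the Borel sigma-algebra.\<close>

definition circle_measure :: "circle measure" where
  "circle_measure =
     distr (restrict_space lborel {0..<1})
       (sigma UNIV {A. abs_circle -` A \<in> sets borel}) abs_circle"

definition square_integrable :: "(circle \<Rightarrow> complex) \<Rightarrow> bool" where
  "square_integrable f \<longleftrightarrow>
     f \<in> borel_measurable circle_measure \<and> integrable circle_measure (\<lambda>x. (cmod (f x))\<^sup>2)"

lemma square_integrable_0: "square_integrable (\<lambda>_. 0)"
  by (simp add: square_integrable_def)

lemma square_integrable_mult:
  assumes "square_integrable f" shows "square_integrable (\<lambda>x. c * f x)"
  using assms by (auto simp: square_integrable_def norm_mult power_mult_distrib)

lemma square_integrable_add:
  assumes f: "square_integrable f" and g: "square_integrable g"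
  shows "square_integrable (\<lambda>x. f x + g x)"
proof -
  have *: "(cmod (a + b))\<^sup>2 \<le> 2 * (cmod a)\<^sup>2 + 2 * (cmod b)\<^sup>2" for a b
  proof -
    have "(cmod (a + b))\<^sup>2 \<le> (cmod a + cmod b)\<^sup>2"
      by (intro power_mono norm_triangle_ineq) simp
    also have "\<dots> \<le> 2 * (cmod a)\<^sup>2 + 2 * (cmod b)\<^sup>2"
      using zero_le_power2[of "cmod a - cmod b"] by (simp add: power2_eq_square algebra_simps)
    finally show ?thesis .
  qed
  have [measurable]: "f \<in> borel_measurable circle_measure" "g \<in> borel_measurable circle_measure"
    using f g by (auto simp: square_integrable_def)
  have "integrable circle_measure (\<lambda>x. 2 * (cmod (f x))\<^sup>2 + 2 * (cmod (g x))\<^sup>2)"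
    using f g by (auto simp: square_integrable_def)
  then have "integrable circle_measure (\<lambda>x. (cmod (f x + g x))\<^sup>2)"
    by (rule Bochner_Integration.integrable_bound) (use * in auto)
  then show ?thesis by (simp add: square_integrable_def)
qed

lemma integrable_mult_cnj:
  assumes f: "square_integrable f" and g: "square_integrable g"
  shows "integrable circle_measure (\<lambda>x. f x * cnj (g x))"
proof -
  have *: "cmod a * cmod b \<le> (cmod a)\<^sup>2 + (cmod b)\<^sup>2" for a b
  proof -
    have "0 \<le> cmod a * cmod b" by simp
    moreover have "2 * (cmod a * cmod b) \<le> (cmod a)\<^sup>2 + (cmod b)\<^sup>2"
      using zero_le_power2[of "cmod a - cmod b"] by (simp add: power2_eq_square algebra_simps)
    ultimately show ?thesis by linarith
  qed
  have [measurable]: "f \<in> borel_measurable circle_measure" "g \<in> borel_measurable circle_measure"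
    using f g by (auto simp: square_integrable_def)
  have [measurable]: "(\<lambda>x. cnj (g x)) \<in> borel_measurable circle_measure"
    by (intro borel_measurable_continuous_on[of cnj] continuous_intros) measurable
  have "integrable circle_measure (\<lambda>x. (cmod (f x))\<^sup>2 + (cmod (g x))\<^sup>2)"
    using f g by (auto simp: square_integrable_def)
  then show ?thesis
    by (rule Bochner_Integration.integrable_bound) (use * in \<open>auto simp: norm_mult\<close>)
qed

quotient_type L2 = "circle \<Rightarrow> complex" /
  partial: "\<lambda>f g. square_integrable f \<and> square_integrable g \<and> (AE x in circle_measure. f x = g x)"
proof (rule part_equivpI)
  show "\<exists>f. square_integrable f \<and> square_integrable f \<and> (AE x in circle_measure. f x = f x)"
    using square_integrable_0 by auto
  show "symp (\<lambda>f g. square_integrable f \<and> square_integrable g \<and> (AE x in circle_measure. f x = g x))"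
    by (auto simp: symp_def)
  show "transp (\<lambda>f g. square_integrable f \<and> square_integrable g \<and> (AE x in circle_measure. f x = g x))"
    by (auto simp: transp_def)
qed

lift_definition scaleC :: "complex \<Rightarrow> L2 \<Rightarrow> L2" (infixr "*\<^sub>C" 75) is "\<lambda>c f x. c * f x"
  by (auto intro: square_integrable_mult)

lift_definition cinner :: "L2 \<Rightarrow> L2 \<Rightarrow> complex"
  is "\<lambda>f g. LINT x|circle_measure. f x * cnj (g x)"
  by (intro integral_cong_AE)
     (auto simp: square_integrable_def intro!: borel_measurable_times borel_measurable_continuous_on[of cnj] continuous_intros)

instantiation L2 :: real_inner
begin

lift_definition zero_L2 :: L2 is "\<lambda>_. 0" by (simp add: square_integrable_0)

lift_definition plus_L2 :: "L2 \<Rightarrow> L2 \<Rightarrow> L2" is "\<lambda>f g x. f x + g x"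
  by (auto intro: square_integrable_add)

definition uminus_L2 :: "L2 \<Rightarrow> L2" where "uminus_L2 f = (-1) *\<^sub>C f"

definition minus_L2 :: "L2 \<Rightarrow> L2 \<Rightarrow> L2" where "minus_L2 f g = f + (- g)"

definition scaleR_L2 :: "real \<Rightarrow> L2 \<Rightarrow> L2" where "scaleR_L2 r f = complex_of_real r *\<^sub>C f"

definition inner_L2 :: "L2 \<Rightarrow> L2 \<Rightarrow> real" where "inner_L2 f g = Re (cinner f g)"

definition norm_L2 :: "L2 \<Rightarrow> real" where "norm_L2 f = sqrt (f \<bullet> f)"

definition sgn_L2 :: "L2 \<Rightarrow> L2" where "sgn_L2 f = inverse (norm f) *\<^sub>R f"

definition dist_L2 :: "L2 \<Rightarrow> L2 \<Rightarrow> real" where "dist_L2 f g = norm (f - g)"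

definition uniformity_L2 :: "(L2 \<times> L2) filter" where
  "uniformity_L2 = (INF e\<in>{0<..}. principal {(f, g). dist f g < e})"

definition open_L2 :: "L2 set \<Rightarrow> bool" where
  "open_L2 U \<longleftrightarrow> (\<forall>f\<in>U. eventually (\<lambda>(f', g). f' = f \<longrightarrow> g \<in> U) uniformity)"

lemma cinner_add_left: "cinner (f + g) h = cinner f h + cinner g (h :: L2)"
  by transfer (auto simp: distrib_right integrable_mult_cnj)

lemma cinner_scaleC_left: "cinner (c *\<^sub>C f) h = c * cinner f h"
  by transfer (simp add: mult.assoc)

lemma cinner_commute: "cinner f g = cnj (cinner g f)"
  by transfer (simp add: mult.commute flip: Bochner_Integration.integral_cnj)

lemma scaleC_add_right: "c *\<^sub>C (f + g) = c *\<^sub>C f + c *\<^sub>C (g :: L2)"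
  by transfer (auto simp: distrib_left intro!: square_integrable_add square_integrable_mult)

lemma scaleC_add_left: "(c + d) *\<^sub>C f = c *\<^sub>C f + d *\<^sub>C (f :: L2)"
  by transfer (auto simp: distrib_right intro!: square_integrable_add square_integrable_mult
     intro: square_integrable_add[OF square_integrable_mult square_integrable_mult])

lemma scaleC_scaleC: "c *\<^sub>C d *\<^sub>C f = (c * d) *\<^sub>C f"
  by transfer (auto simp: mult.assoc intro!: square_integrable_mult)

lemma scaleC_one: "1 *\<^sub>C f = f"
  by transfer auto

instance
proof
  fix f g h :: L2 and a b :: real
  show "f + g + h = f + (g + h)"
    by transfer (auto simp: add.assoc intro!: square_integrable_add)
  show "f + g = g + f"
    by transfer (auto simp: add.commute intro!: square_integrable_add)
  show "0 + f = f" by transfer auto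
  show "- f + f = 0"
    unfolding uminus_L2_def
    by transfer (auto intro!: square_integrable_0
        dest: square_integrable_add[OF square_integrable_mult[of _ "-1"]])
  show "f - g = f + - g" by (simp add: minus_L2_def)
  show "a *\<^sub>R (f + g) = a *\<^sub>R f + a *\<^sub>R g" by (simp add: scaleR_L2_def scaleC_add_right)
  show "(a + b) *\<^sub>R f = a *\<^sub>R f + b *\<^sub>R f" by (simp add: scaleR_L2_def scaleC_add_left)
  show "a *\<^sub>R b *\<^sub>R f = (a * b) *\<^sub>R f" by (simp add: scaleR_L2_def scaleC_scaleC)
  show "1 *\<^sub>R f = f" by (simp add: scaleR_L2_def scaleC_one)
  show "dist f g = norm (f - g)" by (simp add: dist_L2_def)
  show "sgn f = inverse (norm f) *\<^sub>R f" by (simp add: sgn_L2_def)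
  show "uniformity = (INF e\<in>{0<..}. principal {(f, g :: L2). dist f g < e})"
    by (simp add: uniformity_L2_def)
  show "open U \<longleftrightarrow> (\<forall>f\<in>U. eventually (\<lambda>(f', g). f' = f \<longrightarrow> g \<in> U) uniformity)" for U :: "L2 set"
    by (simp add: open_L2_def)
  show "f \<bullet> g = g \<bullet> f"
    unfolding inner_L2_def by (subst cinner_commute) simp
  show "(f + g) \<bullet> h = f \<bullet> h + g \<bullet> h" by (simp add: inner_L2_def cinner_add_left)
  show "(a *\<^sub>R f) \<bullet> g = a * (f \<bullet> g)" by (simp add: inner_L2_def scaleR_L2_def cinner_scaleC_left)
  have sq: "z * cnj z = complex_of_real ((cmod z)\<^sup>2)" for z
    using complex_norm_square[of z] by simp
  show "0 \<le> f \<bullet> f"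
    unfolding inner_L2_def by transfer (simp add: sq del: of_real_power)
  show "f \<bullet> f = 0 \<longleftrightarrow> f = 0"
    unfolding inner_L2_def
  proof transfer
    fix f :: "circle \<Rightarrow> complex"
    assume f: "square_integrable f \<and> square_integrable f \<and> (AE x in circle_measure. f x = f x)"
    have "integral\<^sup>L circle_measure (\<lambda>x. (cmod (f x))\<^sup>2) = 0 \<longleftrightarrow>
        (AE x in circle_measure. (cmod (f x))\<^sup>2 = 0)"
      using f by (intro integral_nonneg_eq_0_iff_AE) (auto simp: square_integrable_def)
    then show "Re (LINT x|circle_measure. f x * cnj (f x)) = 0 \<longleftrightarrow>
        square_integrable f \<and> square_integrable (\<lambda>_. 0) \<and> (AE x in circle_measure. f x = 0)"
      using f by (simp add: sq square_integrable_0 del: of_real_power)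
  qed
  show "norm f = sqrt (f \<bullet> f)" by (simp add: norm_L2_def)
qed

end

interpretation complex_L2: vector_space scaleC
  by unfold_locales (simp_all add: scaleC_add_left scaleC_add_right scaleC_scaleC scaleC_one)


section \<open>Smooth maps and vector fields on a submanifold\<close>

text \<open>On open subsets of Banach spaces, having all iterated directional derivatives Frechet
  differentiable is the usual notion of smoothness: by the uniform boundedness principle the
  higher derivatives are then continuous in operator norm as well.\<close>

primrec Ck_on :: "nat \<Rightarrow> ('a::real_normed_vector \<Rightarrow> 'b::real_normed_vector) \<Rightarrow> 'a set \<Rightarrow> bool" where
  "Ck_on 0 f U \<longleftrightarrow> continuous_on U f"
| "Ck_on (Suc n) f U \<longleftrightarrow>
     (\<forall>x\<in>U. f differentiable (at x)) \<and> (\<forall>v. Ck_on n (\<lambda>x. frechet_derivative f (at x) v) U)"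

text \<open>In the following, a submanifold \<open>M\<close> of an ambient space is given together with its family
  \<open>T\<close> of tangent spaces; tensors (\<open>g\<close>, \<open>\<alpha>\<close>, \<open>\<sigma>\<close>) take the base point as first argument.
  Functions and vector fields on \<open>M\<close> are represented by smooth extensions to a neighbourhood of
  \<open>M\<close>; these are only ever evaluated on \<open>M\<close> and differentiated in directions tangent to \<open>M\<close>, so
  nothing depends on the choice of the extension.\<close>

definition smooth_near :: "'a::real_normed_vector set \<Rightarrow> ('a \<Rightarrow> 'b::real_normed_vector) \<Rightarrow> bool" where
  "smooth_near M f \<longleftrightarrow> (\<exists>U. open U \<and> M \<subseteq> U \<and> (\<forall>n. Ck_on n f U))"

definition vector_field ::
    "'a::real_normed_vector set \<Rightarrow> ('a \<Rightarrow> 'a set) \<Rightarrow> ('a \<Rightarrow> 'a) \<Rightarrow> bool" where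
  "vector_field M T X \<longleftrightarrow> smooth_near M X \<and> (\<forall>p\<in>M. X p \<in> T p)"

definition lie_bracket ::
    "('a::real_normed_vector \<Rightarrow> 'a) \<Rightarrow> ('a \<Rightarrow> 'a) \<Rightarrow> 'a \<Rightarrow> 'a" where
  "lie_bracket X Y p = frechet_derivative Y (at p) (X p) - frechet_derivative X (at p) (Y p)"

text \<open>\<open>d\<alpha>(X, Y) = X(\<alpha>(Y)) - Y(\<alpha>(X)) - \<alpha>([X, Y])\<close>, evaluated on arbitrary vector fields with
  values \<open>u\<close> and \<open>v\<close> at \<open>p\<close>.\<close>

definition exterior_derivative ::
    "'a::real_normed_vector set \<Rightarrow> ('a \<Rightarrow> 'a set) \<Rightarrow> ('a \<Rightarrow> 'a \<Rightarrow> real) \<Rightarrow> 'a \<Rightarrow> 'a \<Rightarrow> 'a \<Rightarrow> real" where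
  "exterior_derivative M T \<alpha> p u v =
     (THE s. \<forall>X Y. vector_field M T X \<longrightarrow> vector_field M T Y \<longrightarrow> X p = u \<longrightarrow> Y p = v \<longrightarrow>
        s = frechet_derivative (\<lambda>x. \<alpha> x (Y x)) (at p) u
          - frechet_derivative (\<lambda>x. \<alpha> x (X x)) (at p) v
          - \<alpha> p (lie_bracket X Y p))"


section \<open>The Levi-Civita connection\<close>

text \<open>\<open>D p v Y\<close> stands for \<open>\<nabla>\<^sub>v Y\<close> at \<open>p\<close>, for \<open>v\<close> tangent to \<open>M\<close> at \<open>p\<close>.\<close>

definition affine_connection ::
    "'a::real_normed_vector set \<Rightarrow> ('a \<Rightarrow> 'a set) \<Rightarrow> ('a \<Rightarrow> 'a \<Rightarrow> ('a \<Rightarrow> 'a) \<Rightarrow> 'a) \<Rightarrow> bool" where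
  "affine_connection M T D \<longleftrightarrow>
     (\<forall>X Y. vector_field M T X \<longrightarrow> vector_field M T Y \<longrightarrow> vector_field M T (\<lambda>p. D p (X p) Y)) \<and>
     (\<forall>p\<in>M. \<forall>v\<in>T p. \<forall>Y Z. vector_field M T Y \<longrightarrow> vector_field M T Z \<longrightarrow>
        (\<forall>q\<in>M. Y q = Z q) \<longrightarrow> D p v Y = D p v Z) \<and>
     (\<forall>p\<in>M. \<forall>u\<in>T p. \<forall>v\<in>T p. \<forall>a b. \<forall>Y. vector_field M T Y \<longrightarrow>
        D p (a *\<^sub>R u + b *\<^sub>R v) Y = a *\<^sub>R D p u Y + b *\<^sub>R D p v Y) \<and>
     (\<forall>p\<in>M. \<forall>v\<in>T p. \<forall>Y Z. vector_field M T Y \<longrightarrow> vector_field M T Z \<longrightarrow>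
        D p v (\<lambda>x. Y x + Z x) = D p v Y + D p v Z) \<and>
     (\<forall>p\<in>M. \<forall>v\<in>T p. \<forall>\<phi> Y. smooth_near M \<phi> \<longrightarrow> vector_field M T Y \<longrightarrow>
        D p v (\<lambda>x. \<phi> x *\<^sub>R Y x) =
          frechet_derivative \<phi> (at p) v *\<^sub>R Y p + \<phi> p *\<^sub>R D p v Y)"

definition torsion_free ::
    "'a::real_normed_vector set \<Rightarrow> ('a \<Rightarrow> 'a set) \<Rightarrow> ('a \<Rightarrow> 'a \<Rightarrow> ('a \<Rightarrow> 'a) \<Rightarrow> 'a) \<Rightarrow> bool" where
  "torsion_free M T D \<longleftrightarrow>
     (\<forall>X Y. vector_field M T X \<longrightarrow> vector_field M T Y \<longrightarrow>
        (\<forall>p\<in>M. D p (X p) Y - D p (Y p) X = lie_bracket X Y p))"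

definition metric_compatible ::
    "'a::real_normed_vector set \<Rightarrow> ('a \<Rightarrow> 'a set) \<Rightarrow> ('a \<Rightarrow> 'a \<Rightarrow> 'a \<Rightarrow> real) \<Rightarrow>
       ('a \<Rightarrow> 'a \<Rightarrow> ('a \<Rightarrow> 'a) \<Rightarrow> 'a) \<Rightarrow> bool" where
  "metric_compatible M T g D \<longleftrightarrow>
     (\<forall>Y Z. vector_field M T Y \<longrightarrow> vector_field M T Z \<longrightarrow>
        (\<forall>p\<in>M. \<forall>v\<in>T p. frechet_derivative (\<lambda>x. g x (Y x) (Z x)) (at p) v =
           g p (D p v Y) (Z p) + g p (Y p) (D p v Z)))"

definition levi_civita ::
    "'a::real_normed_vector set \<Rightarrow> ('a \<Rightarrow> 'a set) \<Rightarrow> ('a \<Rightarrow> 'a \<Rightarrow> 'a \<Rightarrow> real) \<Rightarrow>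
       ('a \<Rightarrow> 'a \<Rightarrow> ('a \<Rightarrow> 'a) \<Rightarrow> 'a) \<Rightarrow> bool" where
  "levi_civita M T g D \<longleftrightarrow>
     affine_connection M T D \<and> torsion_free M T D \<and> metric_compatible M T g D"

abbreviation velocity :: "(real \<Rightarrow> 'a::real_normed_vector) \<Rightarrow> real \<Rightarrow> 'a" where
  "velocity \<gamma> t \<equiv> vector_derivative \<gamma> (at t)"

text \<open>The covariant derivative \<open>(\<nabla>\<^sub>\<gamma>\<^sub>' V)(t)\<close> of a field \<open>V\<close> along \<open>\<gamma>\<close>, for a metric connection: the
  tangent vector \<open>w\<close> for which the product rule
  \<open>g(V, X \<circ> \<gamma>)' = g(\<nabla>\<^sub>\<gamma>\<^sub>' V, X \<circ> \<gamma>) + g(V, \<nabla>\<^sub>\<gamma>\<^sub>' X)\<close>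
  holds at \<open>t\<close> against all vector fields \<open>X\<close> on \<open>M\<close>. In particular, if \<open>V = Y \<circ> \<gamma>\<close> for a vector
  field \<open>Y\<close>, it is \<open>\<nabla>\<^sub>\<gamma>\<^sub>' Y\<close>. (The usual expansion of \<open>V\<close> in a local frame is not available in
  infinite dimensions.)\<close>

definition covariant_derivative_along ::
    "'a::real_normed_vector set \<Rightarrow> ('a \<Rightarrow> 'a set) \<Rightarrow> ('a \<Rightarrow> 'a \<Rightarrow> 'a \<Rightarrow> real) \<Rightarrow>
       ('a \<Rightarrow> 'a \<Rightarrow> ('a \<Rightarrow> 'a) \<Rightarrow> 'a) \<Rightarrow> (real \<Rightarrow> 'a) \<Rightarrow> (real \<Rightarrow> 'a) \<Rightarrow> real \<Rightarrow> 'a" where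
  "covariant_derivative_along M T g D \<gamma> V t =
     (THE w. w \<in> T (\<gamma> t) \<and>
        (\<forall>X. vector_field M T X \<longrightarrow>
           ((\<lambda>s. g (\<gamma> s) (V s) (X (\<gamma> s))) has_real_derivative
              g (\<gamma> t) w (X (\<gamma> t)) + g (\<gamma> t) (V t) (D (\<gamma> t) (velocity \<gamma> t) X)) (at t)))"


section \<open>Magnetic geodesics\<close>

definition lorentz_force ::
    "('a \<Rightarrow> 'a set) \<Rightarrow> ('a \<Rightarrow> 'a \<Rightarrow> 'a \<Rightarrow> real) \<Rightarrow> ('a \<Rightarrow> 'a \<Rightarrow> 'a \<Rightarrow> real) \<Rightarrow> 'a \<Rightarrow> 'a \<Rightarrow> 'a" where
  "lorentz_force T g \<sigma> q u = (THE w. w \<in> T q \<and> (\<forall>v\<in>T q. g q w v = \<sigma> q u v))"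

definition magnetic_geodesic ::
    "'a::real_normed_vector set \<Rightarrow> ('a \<Rightarrow> 'a set) \<Rightarrow> ('a \<Rightarrow> 'a \<Rightarrow> 'a \<Rightarrow> real) \<Rightarrow>
       ('a \<Rightarrow> 'a \<Rightarrow> 'a \<Rightarrow> real) \<Rightarrow> (real \<Rightarrow> 'a) \<Rightarrow> bool" where
  "magnetic_geodesic M T g \<sigma> \<gamma> \<longleftrightarrow>
     (\<forall>t. \<gamma> t \<in> M) \<and>
     (\<forall>t. \<gamma> differentiable (at t)) \<and>
     (\<forall>t. velocity \<gamma> differentiable (at t)) \<and>
     (\<exists>D. levi_civita M T g D \<and>
        (\<forall>t. covariant_derivative_along M T g D \<gamma> (velocity \<gamma>) t =
               lorentz_force T g \<sigma> (\<gamma> t) (velocity \<gamma> t)))"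


section \<open>The magnetic system on the unit sphere\<close>

definition sphere_L2 :: "L2 set" where
  "sphere_L2 = {f. norm f = 1}"

definition tangent_L2 :: "L2 \<Rightarrow> L2 set" where
  "tangent_L2 f = {F. Re (cinner f F) = 0}"

definition metric_L2 :: "L2 \<Rightarrow> L2 \<Rightarrow> L2 \<Rightarrow> real" where
  "metric_L2 f F G = Re (cinner F G)"

definition alpha_L2 :: "L2 \<Rightarrow> L2 \<Rightarrow> real" where
  "alpha_L2 f F = 1/2 * Re (cinner (\<i> *\<^sub>C f) F)"

definition S3 :: "L2 \<Rightarrow> L2 \<Rightarrow> L2 set" where
  "S3 f F = sphere_L2 \<inter> complex_L2.span {f, F}"

text \<open>A round three-sphere: an isometric linear image of the unit sphere of \<open>\<real>\<^sup>4\<close>.\<close>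

definition three_dimensional_sphere :: "L2 set \<Rightarrow> bool" where
  "three_dimensional_sphere A \<longleftrightarrow>
     (\<exists>\<phi> :: real^4 \<Rightarrow> L2. linear \<phi> \<and> (\<forall>x. norm (\<phi> x) = norm x) \<and> A = \<phi> ` sphere 0 1)"

end

theory Submission
  imports Defs
begin

text \<open>On the sphere the geodesic equation reads \<open>\<gamma>'' = \<i> \<gamma>' + c \<gamma>\<close> with
  \<open>c = - \<bar>\<gamma>'\<bar>\<^sup>2 - Re \<langle>\<i> \<gamma>', \<gamma>\<rangle>\<close>, and both terms of \<open>c\<close> are constants of motion. Hence for
  every \<open>g\<close> orthogonal to \<open>f\<close> and \<open>F\<close> the function \<open>\<langle>\<gamma>, g\<rangle>\<close> solves a linear second order
  equation with vanishing initial values, so it is zero and \<open>\<gamma>\<close> stays in the complex span of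
  \<open>f\<close> and \<open>F\<close>. That the Levi-Civita connection, which is only given axiomatically, is the
  tangential part of the ambient derivative follows because their difference is symmetric in two
  arguments and skew in two others.\<close>

section \<open>Smooth maps and vector fields\<close>

lemma vector_field_has_derivative:
  assumes "vector_field M T X" "p \<in> M"
  shows "(X has_derivative frechet_derivative X (at p)) (at p)"
proof -
  obtain U where "M \<subseteq> U" "Ck_on (Suc 0) X U"
    using assms(1) unfolding vector_field_def smooth_near_def by blast
  then show ?thesis
    using assms(2) frechet_derivative_works by auto
qed

lemma vector_field_tangent: "vector_field M T X \<Longrightarrow> p \<in> M \<Longrightarrow> X p \<in> T p"
  by (simp add: vector_field_def)

lemma Ck_on_const: "Ck_on n (\<lambda>_. c) U"
  by (induction n arbitrary: c) (auto intro: derivative_intros)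

lemma Ck_on_bounded_linear:
  assumes "bounded_linear f" shows "Ck_on n f U"
proof (cases n)
  case 0
  then show ?thesis using assms by (simp add: linear_continuous_on)
next
  case (Suc m)
  have d: "(f has_derivative f) (at x)" for x
    using assms by (rule bounded_linear_imp_has_derivative)
  then show ?thesis
    using Suc by (auto simp: Ck_on_const differentiable_def simp flip: frechet_derivative_at[OF d])
qed

text \<open>The map is a constant plus a quadratic term in \<open>q\<close>, so its derivative in a
  fixed direction is linear in the base point and \<open>Ck_on_bounded_linear\<close> takes
  over.\<close>

lemma Ck_on_inner_scaleR:
  fixes u :: "'a::real_inner"
  shows "Ck_on n (\<lambda>q. u - (q \<bullet> u) *\<^sub>R q) U"
proof (cases n)
  case 0
  then show ?thesis by (auto intro!: continuous_intros)
next
  case (Suc m)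
  have d: "((\<lambda>q. u - (q \<bullet> u) *\<^sub>R q) has_derivative
      (\<lambda>v. - ((x \<bullet> u) *\<^sub>R v + (v \<bullet> u) *\<^sub>R x))) (at x)" for x
    by (auto intro!: derivative_eq_intros)
  have "bounded_linear (\<lambda>x. - ((x \<bullet> u) *\<^sub>R v + (v \<bullet> u) *\<^sub>R x))" for v
    by (intro bounded_linear_minus bounded_linear_add
        bounded_linear_scaleR_const bounded_linear_inner_left bounded_linear_scaleR_right)
  then show ?thesis
    using Suc d by (auto simp: Ck_on_bounded_linear differentiable_def simp flip: frechet_derivative_at[OF d])
qed

section \<open>Levi-Civita connection and covariant derivative for the ambient inner product\<close>

text \<open>Only tangential components can agree, since the ambient derivative of a tangent field
  need not be tangent; hence the test against a vector field \<open>Z\<close>.\<close>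

lemma levi_civita_inner:
  fixes M :: "'a::real_inner set"
  assumes D: "levi_civita M T (\<lambda>_. inner) D" and p: "p \<in> M"
    and X: "vector_field M T X" and Y: "vector_field M T Y" and Z: "vector_field M T Z"
  shows "D p (X p) Y \<bullet> Z p = frechet_derivative Y (at p) (X p) \<bullet> Z p"
proof -
  define E where "E X Y Z = (D p (X p) Y - frechet_derivative Y (at p) (X p)) \<bullet> Z p" for X Y Z
  have sym: "E X Y Z = E Y X Z"
    if "vector_field M T X" "vector_field M T Y" for X Y Z
  proof -
    have "D p (X p) Y - D p (Y p) X = lie_bracket X Y p"
      using D that p unfolding levi_civita_def torsion_free_def by blast
    \<comment> \<open>The ambient derivative produces the same bracket, so torsion-freeness becomes
      symmetry of the difference.\<close>
    from arg_cong[OF this, of "\<lambda>w. w \<bullet> Z p"] show ?thesis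
      unfolding E_def lie_bracket_def by (simp add: inner_diff_left)
  qed
  have skew: "E X Y Z = - E X Z Y"
    if "vector_field M T X" "vector_field M T Y" "vector_field M T Z" for X Y Z
  proof -
    \<comment> \<open>Along \<open>X p\<close> the derivative of \<open>Y \<bullet> Z\<close> obeys
      two product rules, the ambient one and metric compatibility; subtracting them gives
      skewness.\<close>
    have "((\<lambda>x. Y x \<bullet> Z x) has_derivative
        (\<lambda>v. Y p \<bullet> frechet_derivative Z (at p) v + frechet_derivative Y (at p) v \<bullet> Z p)) (at p)"
      using that p by (intro has_derivative_inner vector_field_has_derivative)
    from frechet_derivative_at[OF this]
    have "frechet_derivative (\<lambda>x. Y x \<bullet> Z x) (at p) (X p) =
        Y p \<bullet> frechet_derivative Z (at p) (X p) + frechet_derivative Y (at p) (X p) \<bullet> Z p"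
      by metis
    moreover have "frechet_derivative (\<lambda>x. Y x \<bullet> Z x) (at p) (X p) =
        D p (X p) Y \<bullet> Z p + Y p \<bullet> D p (X p) Z"
      using D that p vector_field_tangent[OF that(1) p]
      unfolding levi_civita_def metric_compatible_def by blast
    ultimately show ?thesis
      unfolding E_def by (simp add: inner_diff_left inner_commute algebra_simps)
  qed
  \<comment> \<open>Alternating the two rules runs through all six orders of the arguments and
    returns with a minus sign: \<open>E X Y Z = - E X Y Z\<close>.\<close>
  have "E X Y Z = 0"
    using sym[OF X Y, of Z] skew[OF Y X Z] sym[OF Y Z, of X] skew[OF Z Y X] sym[OF Z X, of Y]
      skew[OF X Z Y] by simp
  then show ?thesis by (simp add: E_def inner_diff_left)
qed

text \<open>By \<open>levi_civita_inner\<close> the defining product rule turns into the ordinary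
  one for \<open>V s \<bullet> X (\<gamma> s)\<close>, so the covariant derivative is the tangential
  part of \<open>V'\<close>. This part \<open>w\<close> is given as a datum because a general
  \<open>T (\<gamma> t)\<close> need not admit orthogonal projections.\<close>

lemma covariant_derivative_along_eq:
  fixes M :: "'a::real_inner set"
  assumes D: "levi_civita M T (\<lambda>_. inner) D" and p: "\<gamma> t \<in> M" and T: "subspace (T (\<gamma> t))"
    and ext: "\<And>u. u \<in> T (\<gamma> t) \<Longrightarrow> \<exists>X. vector_field M T X \<and> X (\<gamma> t) = u"
    and \<gamma>: "(\<gamma> has_vector_derivative \<gamma>') (at t)" "\<gamma>' \<in> T (\<gamma> t)"
    and V: "(V has_vector_derivative V') (at t)" "V t \<in> T (\<gamma> t)"
    and w: "w \<in> T (\<gamma> t)" "\<And>u. u \<in> T (\<gamma> t) \<Longrightarrow> w \<bullet> u = V' \<bullet> u"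
  shows "covariant_derivative_along M T (\<lambda>_. inner) D \<gamma> V t = w"
proof -
  have vel: "velocity \<gamma> t = \<gamma>'"
    using \<gamma>(1) by (rule vector_derivative_at)
  have der: "((\<lambda>s. V s \<bullet> X (\<gamma> s)) has_real_derivative
      V' \<bullet> X (\<gamma> t) + V t \<bullet> D (\<gamma> t) \<gamma>' X) (at t)"
    if X: "vector_field M T X" for X
  proof -
    obtain W where W: "vector_field M T W" "W (\<gamma> t) = \<gamma>'" using ext \<gamma>(2) by blast
    obtain Z where Z: "vector_field M T Z" "Z (\<gamma> t) = V t" using ext V(2) by blast
    have D_eq: "V t \<bullet> D (\<gamma> t) \<gamma>' X = V t \<bullet> frechet_derivative X (at (\<gamma> t)) \<gamma>'"
      using levi_civita_inner[OF D p W(1) X Z(1)] W Z by (simp add: inner_commute)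
    have lin: "linear (frechet_derivative X (at (\<gamma> t)))"
      using vector_field_has_derivative[OF X p] by (rule has_derivative_linear)
    have "((\<lambda>s. X (\<gamma> s)) has_derivative (\<lambda>h. frechet_derivative X (at (\<gamma> t)) (h *\<^sub>R \<gamma>'))) (at t)"
      using has_derivative_compose[OF \<gamma>(1)[unfolded has_vector_derivative_def]
          vector_field_has_derivative[OF X p]] .
    from has_derivative_inner[OF V(1)[unfolded has_vector_derivative_def] this]
    show ?thesis
      unfolding has_field_derivative_def D_eq
      by (rule has_derivative_eq_rhs) (auto simp: linear_scale[OF lin] algebra_simps)
  qed
  show ?thesis
    unfolding covariant_derivative_along_def vel
  proof (rule the_equality)
    show "w \<in> T (\<gamma> t) \<and> (\<forall>X. vector_field M T X \<longrightarrow> ((\<lambda>s. V s \<bullet> X (\<gamma> s)) has_real_derivative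
        w \<bullet> X (\<gamma> t) + V t \<bullet> D (\<gamma> t) \<gamma>' X) (at t))"
      using w der vector_field_tangent p by metis
    fix w' assume w': "w' \<in> T (\<gamma> t) \<and> (\<forall>X. vector_field M T X \<longrightarrow>
      ((\<lambda>s. V s \<bullet> X (\<gamma> s)) has_real_derivative w' \<bullet> X (\<gamma> t) + V t \<bullet> D (\<gamma> t) \<gamma>' X) (at t))"
    \<comment> \<open>Uniqueness: \<open>w' - w\<close> is itself tangent, and testing against a
      field with this value shows that its norm is zero.\<close>
    have diff: "w' - w \<in> T (\<gamma> t)" using w w' T by (simp add: subspace_diff)
    then obtain X where X: "vector_field M T X" "X (\<gamma> t) = w' - w" using ext by blast
    have "w' \<bullet> X (\<gamma> t) = V' \<bullet> X (\<gamma> t)"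
      using DERIV_unique[OF der[OF X(1)]] w' X(1) by fastforce
    then have "(w' - w) \<bullet> (w' - w) = 0"
      using X w(2)[OF diff] by (simp add: inner_diff_left)
    then show "w' = w" by simp
  qed
qed

section \<open>Exterior derivative of a linear one-form\<close>

text \<open>The derivatives of the extensions \<open>X\<close> and \<open>Y\<close> add up to
  \<open>A p \<bullet> lie_bracket X Y p\<close> and cancel, so the value depends on
  \<open>u\<close> and \<open>v\<close> only.\<close>

lemma exterior_derivative_linear_one_form:
  fixes M :: "'a::real_inner set"
  assumes A: "bounded_linear A" and p: "p \<in> M"
    and ext: "\<And>u. u \<in> T p \<Longrightarrow> \<exists>X. vector_field M T X \<and> X p = u"
    and u: "u \<in> T p" and v: "v \<in> T p"
  shows "exterior_derivative M T (\<lambda>x y. A x \<bullet> y) p u v = A u \<bullet> v - A v \<bullet> u"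
proof -
  have der: "frechet_derivative (\<lambda>x. A x \<bullet> X x) (at p) w =
      A p \<bullet> frechet_derivative X (at p) w + A w \<bullet> X p" if "vector_field M T X" for X w
    using frechet_derivative_at[OF has_derivative_inner
        [OF bounded_linear_imp_has_derivative[OF A] vector_field_has_derivative[OF that p]]]
    by metis
  have eq: "frechet_derivative (\<lambda>x. A x \<bullet> Y x) (at p) u - frechet_derivative (\<lambda>x. A x \<bullet> X x) (at p) v
      - A p \<bullet> lie_bracket X Y p = A u \<bullet> v - A v \<bullet> u"
    if "vector_field M T X" "vector_field M T Y" "X p = u" "Y p = v" for X Y
    using that by (simp add: der lie_bracket_def inner_diff_right)
  \<comment> \<open>At least one pair of extensions must exist for the description in
    \<open>exterior_derivative\<close> to determine a unique number.\<close>
  obtain X Y where "vector_field M T X" "vector_field M T Y" "X p = u" "Y p = v"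
    using ext u v by meson
  then show ?thesis
    unfolding exterior_derivative_def by (intro the_equality) (auto simp: eq)
qed

section \<open>Uniqueness for a linear second order equation\<close>

text \<open>Gronwall argument for the energy \<open>y t \<bullet> y t + v t \<bullet> v t\<close>,
  whose derivative is bounded in absolute value by a constant multiple of the energy.\<close>

lemma second_order_linear_zero:
  fixes y v :: "real \<Rightarrow> complex"
  assumes y: "\<And>t. (y has_vector_derivative v t) (at t)"
    and v: "\<And>t. (v has_vector_derivative a * v t + b * y t) (at t)"
    and y0: "y 0 = 0" and v0: "v 0 = 0"
  shows "y t = 0"
proof -
  define e where "e t = y t \<bullet> y t + v t \<bullet> v t" for t
  define e' where "e' t = 2 * (y t \<bullet> v t) + 2 * (v t \<bullet> (a * v t + b * y t))" for t
  \<comment> \<open>Since \<open>2 * (cmod (y t) * cmod (v t)) \<le> e t\<close>, the term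
    \<open>y t \<bullet> v t\<close> contributes 1, the term with \<open>a\<close> contributes
    \<open>2 * cmod a\<close>, and the term with \<open>b\<close> contributes
    \<open>cmod b\<close>.\<close>
  define K where "K = 1 + 2 * cmod a + cmod b"
  have e: "(e has_real_derivative e' t) (at t)" for t
    unfolding e_def e'_def has_field_derivative_def
    by (rule has_derivative_eq_rhs, (rule has_derivative_add has_derivative_inner
          y[unfolded has_vector_derivative_def] v[unfolded has_vector_derivative_def])+)
       (auto simp: algebra_simps inner_commute)
  have bound: "\<bar>e' t\<bar> \<le> K * e t" for t
  proof -
    have 1: "2 * (cmod (y t) * cmod (v t)) \<le> e t"
      using zero_le_power2[of "cmod (y t) - cmod (v t)"]
      by (simp add: e_def dot_square_norm power2_diff)
    have 2: "cmod (v t) * cmod (v t) \<le> e t"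
      by (simp add: e_def dot_square_norm power2_eq_square)
    have "\<bar>v t \<bullet> (a * v t + b * y t)\<bar> \<le> cmod (v t) * (cmod a * cmod (v t) + cmod b * cmod (y t))"
      by (rule order_trans[OF Cauchy_Schwarz_ineq2])
         (intro mult_left_mono order_trans[OF norm_triangle_ineq], auto simp: norm_mult)
    also have "\<dots> = cmod a * (cmod (v t) * cmod (v t)) + cmod b * (cmod (y t) * cmod (v t))"
      by (simp add: algebra_simps)
    finally have 3: "\<bar>v t \<bullet> (a * v t + b * y t)\<bar> \<le> \<dots>" .
    have "\<bar>e' t\<bar> \<le> 2 * \<bar>y t \<bullet> v t\<bar> + 2 * \<bar>v t \<bullet> (a * v t + b * y t)\<bar>"
      unfolding e'_def by linarith
    also have "\<dots> \<le> 2 * (cmod (y t) * cmod (v t)) +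
        2 * (cmod a * (cmod (v t) * cmod (v t)) + cmod b * (cmod (y t) * cmod (v t)))"
      by (intro add_mono mult_left_mono Cauchy_Schwarz_ineq2 3) auto
    also have "\<dots> = 2 * (cmod (y t) * cmod (v t)) + 2 * cmod a * (cmod (v t) * cmod (v t))
        + cmod b * (2 * (cmod (y t) * cmod (v t)))"
      by (simp add: algebra_simps)
    also have "\<dots> \<le> e t + 2 * cmod a * e t + cmod b * e t"
      by (intro add_mono 1 mult_left_mono[OF 1] mult_left_mono[OF 2]) auto
    finally show ?thesis by (simp add: K_def algebra_simps)
  qed
  have "e t \<le> 0"
  proof (cases "t \<ge> 0")
    case True
    \<comment> \<open>The weight \<open>exp (- K * t)\<close> makes the energy nonincreasing forward
      in time from the value 0; for negative times \<open>exp (K * t)\<close> serves in the same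
      way.\<close>
    have "e t * exp (- K * t) \<le> e 0 * exp (- K * 0)"
    proof (rule DERIV_nonpos_imp_nonincreasing[where f = "\<lambda>t. e t * exp (- K * t)", OF True])
      fix x
      have "((\<lambda>t. e t * exp (- K * t)) has_real_derivative (e' x - K * e x) * exp (- K * x)) (at x)"
        by (auto intro!: derivative_eq_intros e simp: algebra_simps)
      moreover have "(e' x - K * e x) * exp (- K * x) \<le> 0"
        using bound[of x] by (intro mult_nonpos_nonneg) auto
      ultimately show "\<exists>z. ((\<lambda>t. e t * exp (- K * t)) has_real_derivative z) (at x) \<and> z \<le> 0"
        by blast
    qed
    then show ?thesis by (simp add: e_def y0 v0 mult_le_0_iff)
  next
    case False
    have "e t * exp (K * t) \<le> e 0 * exp (K * 0)"
    proof (rule DERIV_nonneg_imp_nondecreasing[where f = "\<lambda>t. e t * exp (K * t)"])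
      show "t \<le> 0" using False by simp
      fix x
      have "((\<lambda>t. e t * exp (K * t)) has_real_derivative (e' x + K * e x) * exp (K * x)) (at x)"
        by (auto intro!: derivative_eq_intros e simp: algebra_simps)
      moreover have "(e' x + K * e x) * exp (K * x) \<ge> 0"
        using bound[of x] by (intro mult_nonneg_nonneg) auto
      ultimately show "\<exists>z. ((\<lambda>t. e t * exp (K * t)) has_real_derivative z) (at x) \<and> 0 \<le> z"
        by blast
    qed
    then show ?thesis by (simp add: e_def y0 v0 mult_le_0_iff)
  qed
  moreover have "y t \<bullet> y t \<ge> 0" "v t \<bullet> v t \<ge> 0" by auto
  ultimately have "y t \<bullet> y t = 0" unfolding e_def by linarith
  then show ?thesis by simp
qed

section \<open>Complex inner product, norm and bounded linear maps on \<open>L2\<close>\<close>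

lemma cinner_add_right: "cinner f (g + h) = cinner f g + cinner f (h :: L2)"
  by (metis cinner_add_left cinner_commute complex_cnj_add)

lemma cinner_scaleC_right: "cinner f (c *\<^sub>C g) = cnj c * cinner f g"
  by (metis cinner_scaleC_left cinner_commute complex_cnj_mult)

lemma cinner_diff_left: "cinner (f - g) h = cinner f h - cinner g (h :: L2)"
  using cinner_add_left[of "f - g" g h] by simp

lemma cinner_self: "cinner f f = complex_of_real ((norm f)\<^sup>2)"
proof (rule complex_eqI)
  show "Im (cinner f f) = Im (complex_of_real ((norm f)\<^sup>2))"
    using arg_cong[OF cinner_commute[of f f], of Im] by simp
qed (simp add: power2_norm_eq_inner inner_L2_def)

lemma norm_scaleC: "norm (c *\<^sub>C f) = cmod c * norm (f :: L2)"
proof -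
  have "complex_of_real ((norm (c *\<^sub>C f))\<^sup>2) = c * cnj c * complex_of_real ((norm f)\<^sup>2)"
    by (simp add: cinner_scaleC_left cinner_scaleC_right mult.assoc del: of_real_power
        flip: cinner_self)
  also have "\<dots> = complex_of_real ((cmod c * norm f)\<^sup>2)"
    by (simp add: power_mult_distrib flip: complex_norm_square)
  finally show ?thesis
    by (subst (asm) of_real_eq_iff) (simp add: power2_eq_iff_nonneg)
qed

lemma bounded_linear_scaleC_right: "bounded_linear (\<lambda>f. c *\<^sub>C f)"
proof (rule bounded_linear_intro[where K = "cmod c"])
  show "c *\<^sub>C (r *\<^sub>R f) = r *\<^sub>R (c *\<^sub>C f)" for r f
    by (simp add: scaleR_L2_def scaleC_scaleC mult.commute)
qed (auto simp: scaleC_add_right norm_scaleC mult.commute)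

lemma bounded_linear_cinner_left: "bounded_linear (\<lambda>f. cinner f g)"
proof -
  \<comment> \<open>As \<open>cinner\<close> is conjugate linear in its second argument, its
    imaginary part is the real inner product with \<open>\<i> *\<^sub>C g\<close>.\<close>
  have "cinner f g = complex_of_real (f \<bullet> g) + complex_of_real (f \<bullet> (\<i> *\<^sub>C g)) * \<i>" for f
    by (rule complex_eqI) (auto simp: inner_L2_def cinner_scaleC_right)
  then show ?thesis
    by (simp only:) (intro bounded_linear_add bounded_linear_mult_const bounded_linear_of_real
        bounded_linear_compose[OF bounded_linear_of_real] bounded_linear_inner_left)
qed

section \<open>The magnetic system on the unit sphere\<close>

lemma metric_L2_eq: "metric_L2 = (\<lambda>_. inner)"
  by (intro ext) (simp add: metric_L2_def inner_L2_def)

lemma alpha_L2_eq: "alpha_L2 = (\<lambda>x y. ((1/2) *\<^sub>R (\<i> *\<^sub>C x)) \<bullet> y)"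
  by (intro ext) (simp add: alpha_L2_def inner_L2_def scaleR_L2_def cinner_scaleC_left)

lemma mem_tangent_L2: "F \<in> tangent_L2 f \<longleftrightarrow> f \<bullet> F = 0"
  by (simp add: tangent_L2_def inner_L2_def)

lemma mem_sphere_L2: "f \<in> sphere_L2 \<longleftrightarrow> f \<bullet> f = 1"
  by (simp add: sphere_L2_def norm_eq_1)

lemma subspace_tangent_L2: "subspace (tangent_L2 f)"
  by (auto simp: subspace_def mem_tangent_L2 inner_add_right)

text \<open>At \<open>q\<close> in the unit sphere the constant vector \<open>u\<close> is projected
  orthogonally to the tangent space; the projection fixes \<open>u\<close> at
  \<open>p\<close>.\<close>

lemma vector_field_sphere_L2_extension:
  assumes "u \<in> tangent_L2 p"
  shows "\<exists>X. vector_field sphere_L2 tangent_L2 X \<and> X p = u"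
proof (intro exI conjI)
  show "vector_field sphere_L2 tangent_L2 (\<lambda>q. u - (q \<bullet> u) *\<^sub>R q)"
    unfolding vector_field_def smooth_near_def
    by (auto simp: mem_tangent_L2 mem_sphere_L2 inner_diff_right
        intro!: exI[of _ UNIV] Ck_on_inner_scaleR)
  show "u - (p \<bullet> u) *\<^sub>R p = u"
    using assms by (simp add: mem_tangent_L2)
qed

lemma inner_ii_scaleC: "(\<i> *\<^sub>C u) \<bullet> v = - (u \<bullet> (\<i> *\<^sub>C v))"
  by (simp add: inner_L2_def cinner_scaleC_left cinner_scaleC_right)

lemma inner_ii_ii: "(\<i> *\<^sub>C u) \<bullet> (\<i> *\<^sub>C v) = u \<bullet> v"
  by (simp add: inner_L2_def cinner_scaleC_left cinner_scaleC_right)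

lemma inner_ii_self: "(\<i> *\<^sub>C u) \<bullet> u = 0"
  using inner_ii_scaleC[of u u] inner_commute[of u "\<i> *\<^sub>C u"] by simp

text \<open>Multiplication by \<open>\<i>\<close> is skew, so the two terms of the general formula
  add up and cancel the factor \<open>1/2\<close> of \<open>alpha_L2\<close>.\<close>

lemma exterior_derivative_alpha_L2:
  assumes "p \<in> sphere_L2" "u \<in> tangent_L2 p" "v \<in> tangent_L2 p"
  shows "exterior_derivative sphere_L2 tangent_L2 alpha_L2 p u v = (\<i> *\<^sub>C u) \<bullet> v"
proof -
  have "exterior_derivative sphere_L2 tangent_L2 alpha_L2 p u v =
      ((1/2) *\<^sub>R (\<i> *\<^sub>C u)) \<bullet> v - ((1/2) *\<^sub>R (\<i> *\<^sub>C v)) \<bullet> u"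
    unfolding alpha_L2_eq using assms vector_field_sphere_L2_extension
    by (intro exterior_derivative_linear_one_form bounded_linear_scaleR_right
        bounded_linear_compose[OF bounded_linear_scaleR_right bounded_linear_scaleC_right]) auto
  then show ?thesis
    using inner_ii_scaleC[of v u] by (simp add: inner_commute)
qed

text \<open>The two-form pairs \<open>\<i> *\<^sub>C u\<close> with \<open>v\<close>; its
  representative in the tangent space arises by removing the component of
  \<open>\<i> *\<^sub>C u\<close> along \<open>q\<close>.\<close>

lemma lorentz_force_L2:
  assumes q: "q \<in> sphere_L2" and u: "u \<in> tangent_L2 q"
  shows "lorentz_force tangent_L2 metric_L2 (exterior_derivative sphere_L2 tangent_L2 alpha_L2) q u
    = \<i> *\<^sub>C u - ((\<i> *\<^sub>C u) \<bullet> q) *\<^sub>R q"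
  unfolding lorentz_force_def metric_L2_eq
proof (rule the_equality)
  let ?w = "\<i> *\<^sub>C u - ((\<i> *\<^sub>C u) \<bullet> q) *\<^sub>R q"
  show *: "?w \<in> tangent_L2 q \<and>
      (\<forall>v\<in>tangent_L2 q. ?w \<bullet> v = exterior_derivative sphere_L2 tangent_L2 alpha_L2 q u v)"
    using q u by (auto simp: exterior_derivative_alpha_L2 mem_sphere_L2 mem_tangent_L2
        inner_diff_left inner_diff_right inner_commute)
  fix w assume w: "w \<in> tangent_L2 q \<and>
      (\<forall>v\<in>tangent_L2 q. w \<bullet> v = exterior_derivative sphere_L2 tangent_L2 alpha_L2 q u v)"
  then have "w - ?w \<in> tangent_L2 q"
    using * subspace_diff[OF subspace_tangent_L2] by blast
  then have "w \<bullet> (w - ?w) = ?w \<bullet> (w - ?w)"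
    using w * by auto
  then have "(w - ?w) \<bullet> (w - ?w) = 0"
    by (simp only: inner_diff_left)
  then show "w = ?w" by simp
qed

text \<open>The constancy of \<open>c\<close> is what brings the scalar equations derived from this
  one into the form of \<open>second_order_linear_zero\<close>.\<close>

lemma magnetic_geodesic_L2_equation:
  assumes mg: "magnetic_geodesic sphere_L2 tangent_L2 metric_L2
      (exterior_derivative sphere_L2 tangent_L2 alpha_L2) \<gamma>"
  obtains c where
    "\<And>t. (\<gamma> has_vector_derivative velocity \<gamma> t) (at t)"
    "\<And>t. (velocity \<gamma> has_vector_derivative \<i> *\<^sub>C velocity \<gamma> t + c *\<^sub>R \<gamma> t) (at t)"
proof -
  define v where "v = velocity \<gamma>"
  define a where "a t = vector_derivative v (at t)" for t
  \<comment> \<open>The normal component \<open>- (v t \<bullet> v t)\<close> of the acceleration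
    minus the normal component of \<open>\<i> *\<^sub>C v t\<close>.\<close>
  define c where "c t = - (v t \<bullet> v t) - (\<i> *\<^sub>C v t) \<bullet> \<gamma> t" for t
  obtain D where D: "levi_civita sphere_L2 tangent_L2 (\<lambda>_. inner) D"
    and cov: "\<And>t. covariant_derivative_along sphere_L2 tangent_L2 (\<lambda>_. inner) D \<gamma> v t =
      lorentz_force tangent_L2 metric_L2 (exterior_derivative sphere_L2 tangent_L2 alpha_L2)
        (\<gamma> t) (v t)"
    using mg unfolding magnetic_geodesic_def v_def metric_L2_eq by blast
  have M: "\<gamma> t \<in> sphere_L2" for t
    using mg by (simp add: magnetic_geodesic_def)
  have \<gamma>: "(\<gamma> has_vector_derivative v t) (at t)" and v: "(v has_vector_derivative a t) (at t)" for t
    using mg unfolding magnetic_geodesic_def v_def a_def by (auto simp: vector_derivative_works)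
  have inner_deriv: "((\<lambda>s. x s \<bullet> y s) has_real_derivative x t \<bullet> y' + x' \<bullet> y t) (at t)"
    if "(x has_vector_derivative x') (at t)" "(y has_vector_derivative y') (at t)"
    for x y :: "real \<Rightarrow> L2" and x' y' t
    unfolding has_field_derivative_def
    by (rule has_derivative_eq_rhs[OF has_derivative_inner
          [OF that[unfolded has_vector_derivative_def]]]) (auto simp: algebra_simps)
  \<comment> \<open>Differentiating \<open>\<gamma> t \<bullet> \<gamma> t = 1\<close> gives
    tangency of the velocity; differentiating the result gives the normal component of the
    acceleration.\<close>
  have \<gamma>v: "\<gamma> t \<bullet> v t = 0" for t
  proof -
    have "((\<lambda>_. 1) has_real_derivative \<gamma> t \<bullet> v t + v t \<bullet> \<gamma> t) (at t)"
      using inner_deriv[OF \<gamma> \<gamma>] M by (simp add: mem_sphere_L2)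
    from DERIV_unique[OF this DERIV_const] show ?thesis by (simp add: inner_commute)
  qed
  have \<gamma>a: "\<gamma> t \<bullet> a t = - (v t \<bullet> v t)" for t
  proof -
    have "((\<lambda>_. 0) has_real_derivative \<gamma> t \<bullet> a t + v t \<bullet> v t) (at t)"
      using inner_deriv[OF \<gamma> v, of t] by (simp add: \<gamma>v)
    from DERIV_unique[OF this DERIV_const] show ?thesis by simp
  qed
  have a_eq: "a t = \<i> *\<^sub>C v t + c t *\<^sub>R \<gamma> t" for t
  proof -
    have "covariant_derivative_along sphere_L2 tangent_L2 (\<lambda>_. inner) D \<gamma> v t =
        a t - (\<gamma> t \<bullet> a t) *\<^sub>R \<gamma> t"
      using M \<gamma>v by (intro covariant_derivative_along_eq[OF D _ _ _ \<gamma> _ v])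
        (auto simp: subspace_tangent_L2 vector_field_sphere_L2_extension mem_tangent_L2
          mem_sphere_L2 inner_diff_right inner_diff_left)
    moreover have "lorentz_force tangent_L2 metric_L2
        (exterior_derivative sphere_L2 tangent_L2 alpha_L2) (\<gamma> t) (v t)
        = \<i> *\<^sub>C v t - ((\<i> *\<^sub>C v t) \<bullet> \<gamma> t) *\<^sub>R \<gamma> t"
      using M \<gamma>v by (intro lorentz_force_L2) (auto simp: mem_tangent_L2)
    ultimately show ?thesis
      using cov[of t] by (simp add: c_def \<gamma>a algebra_simps)
  qed
  have iv: "((\<lambda>s. \<i> *\<^sub>C v s) has_vector_derivative \<i> *\<^sub>C a t) (at t)" for t
    by (rule bounded_linear.has_vector_derivative[OF bounded_linear_scaleC_right v])
  \<comment> \<open>The speed is constant because \<open>a t\<close> is orthogonal to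
    \<open>v t\<close>. The other summand is constant because
    \<open>\<i> *\<^sub>C \<gamma> t\<close> is orthogonal to both \<open>\<i> *\<^sub>C v t\<close>
    and \<open>\<gamma> t\<close>, hence to \<open>a t\<close>.\<close>
  have "(c has_real_derivative
      - (v t \<bullet> a t + a t \<bullet> v t) - ((\<i> *\<^sub>C v t) \<bullet> v t + (\<i> *\<^sub>C a t) \<bullet> \<gamma> t)) (at t)" for t
    unfolding c_def[abs_def] by (rule DERIV_diff DERIV_minus inner_deriv v \<gamma> iv)+
  moreover have av: "a t \<bullet> v t = 0" for t
    by (simp add: a_eq inner_add_left inner_ii_self \<gamma>v)
  moreover have "v t \<bullet> a t = 0" for t
    using av by (simp add: inner_commute)
  moreover have "(\<i> *\<^sub>C a t) \<bullet> \<gamma> t = 0" for t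
    using \<gamma>v[of t] inner_ii_scaleC[of "a t" "\<gamma> t"] inner_ii_self[of "\<gamma> t"]
    by (simp add: a_eq inner_add_right inner_ii_ii inner_ii_self inner_commute)
  ultimately have "(c has_real_derivative 0) (at t)" for t
    by (simp add: inner_ii_self)
  then have c0: "c t = c 0" for t
    using DERIV_isconst_all by blast
  have "(v has_vector_derivative \<i> *\<^sub>C v t + c 0 *\<^sub>R \<gamma> t) (at t)" for t
    using v[of t] a_eq[of t] c0[of t] by simp
  with \<gamma> show ?thesis
    using that unfolding v_def by blast
qed

section \<open>Complex planes and the sphere \<open>S3 f F\<close>\<close>

lemma mem_span_pair: "x \<in> complex_L2.span {f, F} \<longleftrightarrow> (\<exists>a b. x = a *\<^sub>C f + b *\<^sub>C F)"
  by (auto simp: complex_L2.span_insert complex_L2.span_singleton diff_eq_eq add.commute)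

text \<open>If \<open>F \<in> span {f}\<close>, then \<open>h = 0\<close> below and the division by \<open>\<langle>h, h\<rangle> = 0\<close> is harmless.\<close>

lemma orthogonal_decomposition_pair:
  fixes f F :: L2
  assumes f: "cinner f f = 1"
  obtains y where "x - y \<in> complex_L2.span {f, F}" "cinner f y = 0" "cinner F y = 0"
proof -
  define h where "h = F - cinner F f *\<^sub>C f"
  define y where "y = x - (cinner x f *\<^sub>C f + (cinner x h / cinner h h) *\<^sub>C h)"
  have hf: "cinner h f = 0" by (simp add: h_def cinner_diff_left cinner_scaleC_left f)
  have yf: "cinner y f = 0"
    by (simp add: y_def cinner_diff_left cinner_add_left cinner_scaleC_left f hf)
  have fh: "cinner f h = 0" using hf cinner_commute[of f h] by simp
  have yh: "cinner y h = 0"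
  proof (cases "h = 0")
    case True
    then have "norm h = 0" by simp
    then show ?thesis
      using cinner_scaleC_right[of y 0 h] True complex_L2.scale_zero_left[of h] by simp
  next
    case False
    then have "cinner h h \<noteq> 0" by (simp add: cinner_self)
    then show ?thesis
      by (simp add: y_def cinner_diff_left cinner_add_left cinner_scaleC_left fh)
  qed
  have F: "F = h + cinner F f *\<^sub>C f" by (simp add: h_def)
  have "cinner y F = 0"
    by (subst F) (simp add: cinner_add_right cinner_scaleC_right yh yf)
  moreover have "x - y \<in> complex_L2.span {f, F}"
    unfolding y_def h_def
    by (simp add: complex_L2.span_add complex_L2.span_scale complex_L2.span_diff complex_L2.span_base)
  ultimately show ?thesis
    using that yf cinner_commute[of f y] cinner_commute[of F y] by simp
qed

text \<open>Gram-Schmidt gives a complex orthonormal basis \<open>f\<close>, \<open>e\<close> of the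
  plane; real and imaginary parts of the coefficients are four isometric real coordinates. The
  hypothesis \<open>f \<noteq> F\<close> excludes that \<open>{f, F}\<close> collapses to an
  independent singleton.\<close>

lemma three_dimensional_sphere_S3:
  assumes f: "f \<in> sphere_L2" and indep: "complex_L2.independent {f, F}" and "f \<noteq> F"
  shows "three_dimensional_sphere (S3 f F)"
proof -
  have ff: "cinner f f = 1" using f by (simp add: cinner_self sphere_L2_def)
  \<comment> \<open>Decomposing \<open>F\<close> against the pair \<open>f\<close>, \<open>f\<close>
    yields its part orthogonal to \<open>f\<close>, as \<open>{f, f} = {f}\<close>.\<close>
  obtain h where h: "F - h \<in> complex_L2.span {f}" "cinner f h = 0"
    using orthogonal_decomposition_pair[OF ff, of F f] by auto
  then obtain k where "F - h = k *\<^sub>C f"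
    by (auto simp: complex_L2.span_singleton)
  then have k: "F = k *\<^sub>C f + h" by (simp add: diff_eq_eq)
  have "h \<noteq> 0"
  proof
    assume "h = 0"
    then have "F \<in> complex_L2.span {f}" using h by simp
    moreover have "F \<notin> complex_L2.span {f}"
      using indep \<open>f \<noteq> F\<close> complex_L2.independent_insert[of F "{f}"] by (auto simp: insert_commute)
    ultimately show False by simp
  qed
  define e where "e = complex_of_real (inverse (norm h)) *\<^sub>C h"
  have e: "cinner e e = 1"
    using \<open>h \<noteq> 0\<close> by (simp add: e_def cinner_self norm_scaleC norm_inverse)
  have fe: "cinner f e = 0" "cinner e f = 0"
    using h(2) cinner_commute[of f h] by (auto simp: e_def cinner_scaleC_right cinner_scaleC_left)
  have F: "F = k *\<^sub>C f + complex_of_real (norm h) *\<^sub>C e"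
    using \<open>h \<noteq> 0\<close> by (simp add: e_def scaleC_scaleC scaleC_one k flip: of_real_mult)
  have span: "complex_L2.span {f, F} = complex_L2.span {f, e}"
  proof (rule antisym)
    have "F \<in> complex_L2.span {f, e}"
      unfolding F mem_span_pair by blast
    then show "complex_L2.span {f, F} \<subseteq> complex_L2.span {f, e}"
      by (intro complex_L2.span_minimal) (auto simp: complex_L2.span_base)
    have "F - k *\<^sub>C f \<in> complex_L2.span {f, F}"
      by (simp add: complex_L2.span_diff complex_L2.span_scale complex_L2.span_base)
    then have "h \<in> complex_L2.span {f, F}" using k by simp
    then have "e \<in> complex_L2.span {f, F}"
      unfolding e_def by (rule complex_L2.span_scale)
    then show "complex_L2.span {f, e} \<subseteq> complex_L2.span {f, F}"
      by (intro complex_L2.span_minimal) (auto simp: complex_L2.span_base)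
  qed
  define \<phi> :: "real^4 \<Rightarrow> L2" where
    "\<phi> x = Complex (x $ 1) (x $ 2) *\<^sub>C f + Complex (x $ 3) (x $ 4) *\<^sub>C e" for x
  have "linear \<phi>"
  proof
    have *: "Complex (a + b) (c + d) = Complex a c + Complex b d" for a b c d
      by (simp add: complex_eq_iff)
    show "\<phi> (x + y) = \<phi> x + \<phi> y" for x y
      unfolding \<phi>_def by (simp add: * scaleC_add_left)
    have **: "Complex (r * a) (r * b) = complex_of_real r * Complex a b" for r a b
      by (simp add: complex_eq_iff)
    show "\<phi> (r *\<^sub>R x) = r *\<^sub>R \<phi> x" for r x
      unfolding \<phi>_def by (simp add: ** scaleR_L2_def scaleC_add_right scaleC_scaleC)
  qed
  moreover have norm: "norm (\<phi> x) = norm x" for x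
  proof -
    have "cinner (\<phi> x) (\<phi> x) = Complex (x $ 1) (x $ 2) * cnj (Complex (x $ 1) (x $ 2))
        + Complex (x $ 3) (x $ 4) * cnj (Complex (x $ 3) (x $ 4))"
      by (simp add: \<phi>_def cinner_add_left cinner_add_right cinner_scaleC_left
          cinner_scaleC_right ff e fe)
    then have "\<phi> x \<bullet> \<phi> x = x \<bullet> x"
      by (simp add: inner_L2_def inner_vec_def sum_4)
    then show ?thesis by (simp add: norm_eq_sqrt_inner)
  qed
  moreover have "S3 f F = \<phi> ` sphere 0 1"
  proof (intro equalityI subsetI)
    fix x assume x: "x \<in> S3 f F"
    then obtain a b where ab: "x = a *\<^sub>C f + b *\<^sub>C e"
      by (auto simp: S3_def span mem_span_pair)
    define z :: "real^4" where "z = (\<chi> i. if i = 1 then Re a else if i = 2 then Im a else if i = 3 then Re b else Im b)"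
    have "x = \<phi> z" by (simp add: ab \<phi>_def z_def)
    moreover have "norm z = 1"
      using x norm[of z] \<open>x = \<phi> z\<close> by (simp add: S3_def sphere_L2_def)
    ultimately show "x \<in> \<phi> ` sphere 0 1" by auto
  next
    fix x assume "x \<in> \<phi> ` sphere 0 1"
    then obtain z where "x = \<phi> z" "norm z = 1" by auto
    moreover have "\<phi> z \<in> complex_L2.span {f, e}"
      unfolding \<phi>_def mem_span_pair by blast
    ultimately show "x \<in> S3 f F"
      using norm[of z] by (simp add: S3_def span sphere_L2_def)
  qed
  ultimately show ?thesis unfolding three_dimensional_sphere_def by blast
qed

section \<open>Confinement of magnetic geodesics to the three-sphere\<close>

theorem corollary3p11:
  fixes \<gamma> :: "real \<Rightarrow> L2" and f F :: L2
  assumes "f \<in> sphere_L2" and "F \<in> tangent_L2 f"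
    and "magnetic_geodesic sphere_L2 tangent_L2 metric_L2
           (exterior_derivative sphere_L2 tangent_L2 alpha_L2) \<gamma>"
    and "\<gamma> 0 = f" and "velocity \<gamma> 0 = F"
  shows "range \<gamma> \<subseteq> S3 f F \<and>
         (complex_L2.independent {f, F} \<longrightarrow> three_dimensional_sphere (S3 f F))"
proof (intro conjI impI)
  obtain c where \<gamma>: "\<And>t. (\<gamma> has_vector_derivative velocity \<gamma> t) (at t)"
    and v: "\<And>t. (velocity \<gamma> has_vector_derivative \<i> *\<^sub>C velocity \<gamma> t + c *\<^sub>R \<gamma> t) (at t)"
    using magnetic_geodesic_L2_equation[OF assms(3)] by blast
  have ff: "cinner f f = 1" using assms(1) by (simp add: cinner_self sphere_L2_def)
  show "range \<gamma> \<subseteq> S3 f F"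
  proof clarify
    fix t
    \<comment> \<open>\<open>y\<close> is the part of \<open>\<gamma> t\<close> orthogonal to
      \<open>f\<close> and \<open>F\<close>. It stays fixed while \<open>s\<close> varies, so
      \<open>cinner (\<gamma> s) y\<close> solves a scalar equation with initial values
      \<open>cinner f y = 0\<close> and \<open>cinner F y = 0\<close>.\<close>
    obtain y where y: "\<gamma> t - y \<in> complex_L2.span {f, F}" "cinner f y = 0" "cinner F y = 0"
      using orthogonal_decomposition_pair[OF ff] by blast
    have d: "((\<lambda>s. cinner (\<gamma> s) y) has_vector_derivative cinner (velocity \<gamma> s) y) (at s)" for s
      by (rule bounded_linear.has_vector_derivative[OF bounded_linear_cinner_left \<gamma>])
    have d': "((\<lambda>s. cinner (velocity \<gamma> s) y) has_vector_derivative
        \<i> * cinner (velocity \<gamma> s) y + complex_of_real c * cinner (\<gamma> s) y) (at s)" for s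
      using bounded_linear.has_vector_derivative[OF bounded_linear_cinner_left v, of y s]
      by (simp add: cinner_add_left cinner_scaleC_left scaleR_L2_def)
    have "cinner (\<gamma> t) y = 0"
      using second_order_linear_zero[OF d d'] y(2,3) assms(4,5) by simp
    \<comment> \<open>\<open>\<gamma> t - y\<close> lies in the span, to which \<open>y\<close> is
      orthogonal, so \<open>y\<close> turns out orthogonal to itself.\<close>
    moreover have "cinner (\<gamma> t - y) y = 0"
      using y by (auto simp: mem_span_pair cinner_add_left cinner_scaleC_left)
    ultimately have "cinner y y = 0" by (simp add: cinner_diff_left)
    then have "y = 0" by (simp add: cinner_self)
    then show "\<gamma> t \<in> S3 f F"
      using y(1) assms(3) by (simp add: S3_def magnetic_geodesic_def)
  qed
  \<comment> \<open>A unit vector is not orthogonal to itself.\<close>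
  have "f \<noteq> F"
    using assms(1,2) by (auto simp: mem_sphere_L2 mem_tangent_L2)
  then show "three_dimensional_sphere (S3 f F)" if "complex_L2.independent {f, F}"
    using three_dimensional_sphere_S3 assms(1) that by blast
qed

end
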